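(* Let $r>1$. Then every binary matroid of rank at most $r$ (that is, every member of $\mathcal{M}_r$) can be obtained from $P_r$ via a finite sequence of operations each of which is a pointed swap or a complementation inside a projective hyperplane.
   Context: $P_r=PG(r-1,2)$ is the rank-$r$ binary projective geometry, i.e. the simple binary matroid on the nonzero vectors of $GF(2)^r$. $\mathcal{M}_r$ is the set of all restrictions of the fixed matroid $P_r$ (to arbitrary subsets of $E(P_r)$, including the empty set). All binary matroids considered are simple, and a binary matroid of rank at most $r$ is regarded as a member of $\mathcal{M}_r$. For $M\in\mathcal{M}_r$ and $A\subseteq E(P_r)$, $M\triangle A$ denotes the restriction of $P_r$ to the symmetric difference $E(M)\bigtriangleup A$. A projective hyperplane is a hyperplane $H$ of $P_r$; complementation inside $H$ is the operation $M\mapsto M\triangle H$. Pointed swap: for $M\in\mathcal{M}_r$, colour an element of $P_r$ green if it is in $E(M)$ and red otherwise. Let $f\in E(P_r)$. The pointed swap of $M$ with respect to $f$ is the matroid in $\mathcal{M}_r$ whose ground set is the set of green elements after, for every line $\{f,f',f''\}$ of $P_r$ through $f$, swapping the colours of $f'$ and $f''$ if these colours differ; the colour of $f$ is unchanged. (Equivalently, identifying elements with nonzero vectors, each $e\ne f$ in $E(M)$ is replaced by $e+f$, while $f$ remains in the ground set if and only if $f\in E(M)$.) Pointed swaps may be done with respect to any $f\in E(P_r)$. *)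

theory Defs
  imports "HOL-Analysis.Cartesian_Space" "HOL-Library.Z2"
begin

instance bit :: finite
proof
  have "(UNIV :: bit set) \<subseteq> {0, 1}"
    by (metis (full_types) bit_not_one_iff insert_iff subsetI)
  then show "finite (UNIV :: bit set)"
    using finite_subset by blast
qed

section \<open>Matroids given by their independent sets\<close>

record 'a matroid =
  ground :: "'a set"
  indeps :: "'a set set"

definition matroid_axioms :: "'a matroid \<Rightarrow> bool" where
  "matroid_axioms M \<longleftrightarrow>
     finite (ground M) \<and> indeps M \<subseteq> Pow (ground M) \<and> {} \<in> indeps M \<and>
     (\<forall>I\<in>indeps M. \<forall>J. J \<subseteq> I \<longrightarrow> J \<in> indeps M) \<and>
     (\<forall>I\<in>indeps M. \<forall>J\<in>indeps M. card I < card J \<longrightarrow> (\<exists>e\<in>J - I. insert e I \<in> indeps M))"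

definition restriction :: "'a matroid \<Rightarrow> 'a set \<Rightarrow> 'a matroid" where
  "restriction M X = \<lparr>ground = ground M \<inter> X, indeps = {I \<in> indeps M. I \<subseteq> X}\<rparr>"

definition mrank :: "'a matroid \<Rightarrow> 'a set \<Rightarrow> nat" where
  "mrank M X = Max (card ` {I \<in> indeps M. I \<subseteq> X})"

definition flat :: "'a matroid \<Rightarrow> 'a set \<Rightarrow> bool" where
  "flat M F \<longleftrightarrow> F \<subseteq> ground M \<and> (\<forall>e\<in>ground M - F. mrank M F < mrank M (insert e F))"

definition mline :: "'a matroid \<Rightarrow> 'a set \<Rightarrow> bool" where
  "mline M L \<longleftrightarrow> flat M L \<and> mrank M L = 2"

definition hyperplane :: "'a matroid \<Rightarrow> 'a set \<Rightarrow> bool" where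
  "hyperplane M H \<longleftrightarrow> flat M H \<and> Suc (mrank M H) = mrank M (ground M)"

section \<open>Restrictions of the binary projective geometry\<close>

text \<open>The rank is carried by the index type: \<open>PG :: (bit^'r) matroid\<close> is
  \<open>PG(r-1,2)\<close> for \<open>r = CARD('r)\<close>.\<close>

definition PG :: "(bit^'r) matroid" where
  "PG = \<lparr>ground = UNIV - {0}, indeps = {I. vec.independent I}\<rparr>"

definition PG_restrictions :: "(bit^'r) matroid set" where
  "PG_restrictions = {restriction PG X | X. X \<subseteq> ground PG}"

definition mtriangle :: "(bit^'r) matroid \<Rightarrow> (bit^'r) set \<Rightarrow> (bit^'r) matroid" where
  "mtriangle M A = restriction PG (sym_diff (ground M) A)"

text \<open>Swapping the colours of \<open>e\<close> and \<open>e'\<close> when they differ means exchanging them in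
  any case, so \<open>e \<noteq> f\<close> becomes green iff the third point \<open>e'\<close> of the line through
  \<open>f\<close> and \<open>e\<close> was green.\<close>

definition pointed_swap :: "(bit^'r) matroid \<Rightarrow> bit^'r \<Rightarrow> (bit^'r) matroid" where
  "pointed_swap M f = restriction PG
     {e \<in> ground PG. if e = f then e \<in> ground M
        else \<exists>e'\<in>ground M. e' \<noteq> e \<and> e' \<noteq> f \<and> mline PG {f, e, e'}}"

definition swap_or_complement :: "(bit^'r) matroid \<Rightarrow> (bit^'r) matroid \<Rightarrow> bool" where
  "swap_or_complement M N \<longleftrightarrow>
     (\<exists>f\<in>ground PG. N = pointed_swap M f) \<or>
     (\<exists>H. hyperplane PG H \<and> N = mtriangle M H)"

section \<open>Agreement with the linear-algebraic descriptions\<close>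

lemma bit_vec_add_self [simp]: "x + x = (0 :: bit^'r)"
  by (simp add: vec_eq_iff)

lemma ground_PG [simp]: "ground PG = UNIV - {0}"
  by (simp add: PG_def)

lemma indeps_PG: "I \<in> indeps PG \<longleftrightarrow> vec.independent I"
  by (simp add: PG_def)

lemma mrank_PG: "mrank PG X = vec.dim (X :: (bit^'r) set)"
  unfolding mrank_def
proof (rule Max_eqI)
  show "finite (card ` {I \<in> indeps PG. I \<subseteq> X})"
    by (rule finite_imageI) (rule finite)
next
  fix n assume "n \<in> card ` {I \<in> indeps PG. I \<subseteq> X}"
  then obtain I where "n = card I" "vec.independent I" "I \<subseteq> X"
    by (auto simp: indeps_PG)
  then show "n \<le> vec.dim X"
    using vec.independent_card_le_dim by blast
next
  obtain B where "B \<subseteq> X" "vec.independent B" "card B = vec.dim X"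
    using vec.basis_exists[of X] by metis
  then show "vec.dim X \<in> card ` {I \<in> indeps PG. I \<subseteq> X}"
    by (intro image_eqI[of _ _ B]) (simp_all add: indeps_PG)
qed

lemma matroid_axioms_PG: "matroid_axioms (PG :: (bit^'r) matroid)"
  unfolding matroid_axioms_def
proof (intro conjI ballI impI allI)
  show "indeps (PG :: (bit^'r) matroid) \<subseteq> Pow (ground PG)"
    by (auto simp: indeps_PG vec.dependent_zero)
next
  fix I J :: "(bit^'r) set"
  assume "I \<in> indeps PG" "J \<in> indeps PG" "card I < card J"
  then have I: "vec.independent I" and J: "vec.independent J" and "vec.dim I < vec.dim J"
    by (auto simp: indeps_PG vec.dim_eq_card_independent)
  then have "\<not> J \<subseteq> vec.span I"
    using vec.dim_mono[of J I] by linarith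
  then obtain e where e: "e \<in> J" "e \<notin> vec.span I" by blast
  then have "vec.independent (insert e I)" "e \<notin> I"
    using I by (auto simp: vec.independent_insert vec.span_base)
  with e show "\<exists>e\<in>J - I. insert e I \<in> indeps PG"
    by (auto simp: indeps_PG)
qed (auto simp: indeps_PG vec.independent_empty dest: vec.independent_mono)

lemma flat_PG: "flat PG F \<longleftrightarrow> (\<exists>S. vec.subspace S \<and> F = S - {0 :: bit^'r})"
proof
  assume F: "flat PG F"
  have "vec.span F - {0} \<subseteq> F"
    using F unfolding flat_def mrank_PG
    by (force simp: vec.dim_insert split: if_splits)
  then have "F = vec.span F - {0}"
    using F by (auto simp: flat_def vec.span_base)
  then show "\<exists>S. vec.subspace S \<and> F = S - {0}"
    using vec.subspace_span by blast
next
  assume "\<exists>S. vec.subspace S \<and> F = S - {0}"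
  then obtain S where S: "vec.subspace S" "F = S - {0}" by blast
  have "vec.span F = S"
    using S by (metis vec.span_delete_0 vec.span_eq_iff)
  then show "flat PG F"
    using S \<open>vec.span F = S\<close> by (auto simp: flat_def mrank_PG vec.dim_insert simp del: vec.span_delete_0)
qed

lemma hyperplane_PG:
  "hyperplane PG H \<longleftrightarrow>
     (\<exists>S. vec.subspace S \<and> Suc (vec.dim S) = CARD('r) \<and> H = S - {0 :: bit^'r})"
proof -
  have del: "vec.dim (S - {0 :: bit^'r}) = vec.dim S" for S
    by (metis vec.dim_span vec.span_delete_0)
  have "vec.dim (UNIV - {0 :: bit^'r}) = CARD('r)"
    by (simp only: del vec.dim_UNIV card_cart_basis)
  then show ?thesis
    unfolding hyperplane_def flat_PG mrank_PG ground_PG using del by metis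
qed

lemma mline_PG:
  fixes f e e' :: "bit^'r"
  assumes "f \<noteq> 0" "e \<noteq> 0" "e \<noteq> f" "e' \<noteq> e" "e' \<noteq> f"
  shows "mline PG {f, e, e'} \<longleftrightarrow> e' = e + f"
proof -
  have scale: "c *s x = (if c = 0 then 0 else x)" for c :: bit and x :: "bit^'r"
    by (cases c) auto
  have cancel: "x + (x + y) = y" for x y :: "bit^'r"
    by (simp add: add.assoc[symmetric])
  have span2: "vec.span {f, e} = {0, f, e, e + f}"
  proof
    show "vec.span {f, e} \<subseteq> {0, f, e, e + f}"
      by (rule vec.span_minimal)
        (auto simp: vec.subspace_def scale add_ac cancel)
    show "{0, f, e, e + f} \<subseteq> vec.span {f, e}"
      by (auto intro: vec.span_base vec.span_add vec.span_zero)
  qed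
  have "f \<notin> vec.span {e}"
    using assms by (auto simp: vec.span_singleton scale)
  then have d2: "vec.dim {f, e} = 2"
    using assms by (simp add: vec.dim_insert)
  have ef: "e + f \<noteq> 0"
    using assms by (metis add.right_neutral add.assoc bit_vec_add_self add.commute)
  show ?thesis
  proof
    assume L: "mline PG {f, e, e'}"
    then obtain S where S: "vec.subspace S" "{f, e, e'} = S - {0}"
      by (auto simp: mline_def flat_PG)
    then have "e + f \<in> {f, e, e'}"
      using ef vec.subspace_add[of S e f] by blast
    then show "e' = e + f"
      using assms by auto
  next
    assume e': "e' = e + f"
    have "{f, e, e'} = vec.span {f, e} - {0}"
      using assms ef by (auto simp: span2 e')
    moreover have "vec.dim {f, e, e'} = 2"
    proof -
      have "vec.span {f, e, e'} = vec.span {f, e}"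
        using calculation by (metis vec.span_delete_0 vec.span_span)
      then show ?thesis by (metis d2 vec.dim_span)
    qed
    ultimately show "mline PG {f, e, e'}"
      using vec.subspace_span by (auto simp: mline_def flat_PG mrank_PG)
  qed
qed

lemma ground_pointed_swap:
  fixes f :: "bit^'r"
  assumes M: "ground M \<subseteq> ground PG" and f: "f \<in> ground PG"
  shows "ground (pointed_swap M f) = (\<lambda>e. if e = f then e else e + f) ` ground M"
proof -
  have nz: "x + f \<noteq> 0" if "x \<noteq> f" for x :: "bit^'r"
    using that by (metis add.assoc add.left_neutral add.right_neutral bit_vec_add_self)
  have cancel: "x + f + f = x" for x :: "bit^'r"
    by (simp add: add.assoc)
  have "e \<in> ground (pointed_swap M f) \<longleftrightarrow>
      (if e = f then f \<in> ground M else e \<noteq> 0 \<and> e + f \<in> ground M)" for e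
  proof (cases "e = f \<or> e = 0")
    case True
    then show ?thesis using f by (auto simp: pointed_swap_def restriction_def)
  next
    case False
    have "e + f \<noteq> e" "e + f \<noteq> f" using f False by auto
    then show ?thesis
      using False f mline_PG[of f e]
      by (auto simp: pointed_swap_def restriction_def intro!: bexI[of _ "e + f"])
  qed
  moreover have "e \<in> (\<lambda>e. if e = f then e else e + f) ` ground M \<longleftrightarrow>
      (if e = f then f \<in> ground M else e \<noteq> 0 \<and> e + f \<in> ground M)" for e
  proof (cases "e = f")
    case True
    have "x + f \<noteq> f" if "x \<in> ground M" for x
      using that M by auto
    then show ?thesis
      using True by (auto simp: image_iff)
  next
    case False
    show ?thesis
    proof
      assume "e \<in> (\<lambda>e. if e = f then e else e + f) ` ground M"
      then obtain x where "x \<in> ground M" "x \<noteq> f" "e = x + f"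
        using False by (auto split: if_splits)
      then show "if e = f then f \<in> ground M else e \<noteq> 0 \<and> e + f \<in> ground M"
        using False nz cancel by simp
    next
      assume "if e = f then f \<in> ground M else e \<noteq> 0 \<and> e + f \<in> ground M"
      then have "e + f \<in> ground M" "e + f \<noteq> f"
        using False by auto
      then show "e \<in> (\<lambda>e. if e = f then e else e + f) ` ground M"
        using cancel by (intro image_eqI[of _ _ "e + f"]) simp_all
    qed
  qed
  ultimately show ?thesis by blast
qed

end

theory Submission
  imports Defs "HOL-Combinatorics.Transposition"
begin

text \<open>
  On a line \<open>{f, g, f + g}\<close> the three pointed swaps at its points act as the three
  transpositions, while off the line they act as translations by \<open>f\<close>, \<open>g\<close> and
  \<open>f + g\<close>, whose sum is zero. Hence the product of the three swaps is a single
  transposition of two points, and pointed swaps act as the full symmetric group on the points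
  of the geometry. So only the sizes of ground sets matter. If a hyperplane has \<open>h = 2 t + 1\<close>
  points, complementing in one that meets a set of size \<open>n\<close> in \<open>k\<close> points gives size
  \<open>n + h - 2 k\<close>. With \<open>k = t\<close> and \<open>k = t + 1\<close> all sizes between \<open>t\<close> and
  \<open>3 t + 3\<close> are connected, and with \<open>k = 0\<close> and \<open>k = h\<close> the remaining ones are joined to them.
\<close>

text \<open>Injective only on nonzero vectors: both \<open>0\<close> and \<open>f\<close> go to
  \<open>f\<close>, so zero is kept out of every set that is moved.\<close>

definition point_swap :: "bit^'r \<Rightarrow> bit^'r \<Rightarrow> bit^'r" where
  "point_swap f e = (if e = f then e else e + f)"

lemma bit_vec_add_cancel [simp]:
  fixes x y :: "bit^'r"
  shows "x + (x + y) = y" "x + y + y = x"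
  by (simp_all only: add.assoc[symmetric] bit_vec_add_self add_0_left)
    (simp only: add.assoc bit_vec_add_self add_0_right)

lemma bit_vec_add_eq_0_iff: "x + y = 0 \<longleftrightarrow> x = (y :: bit^'r)"
  by (metis bit_vec_add_cancel(2) add_0 bit_vec_add_self)

lemma point_swap_nonzero: "e \<noteq> 0 \<Longrightarrow> point_swap f e \<noteq> 0"
  by (auto simp: point_swap_def bit_vec_add_eq_0_iff)

lemma point_swap_line_eq_transpose:
  fixes a b e :: "bit^'r"
  assumes "a \<noteq> 0" "b \<noteq> 0" "a \<noteq> b" "e \<noteq> 0"
  shows "point_swap a (point_swap (a + b) (point_swap b e)) = Transposition.transpose a b e"
proof -
  have abb: "a + b \<noteq> a" "a + b \<noteq> b" "b + (a + b) = a" "a + (a + b) = b"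
    using assms by (simp_all add: add.left_commute)
  consider "e = a" | "e = b" | "e = a + b" | "e \<noteq> a" "e \<noteq> b" "e \<noteq> a + b" by blast
  then show ?thesis
  proof cases
    case 4
    \<comment> \<open>No intermediate point is the centre of the next swap: \<open>e + b\<close>
      differs from \<open>a + b\<close> since \<open>e \<noteq> a\<close>, and \<open>e + a\<close>
      from \<open>a\<close> since \<open>e \<noteq> 0\<close>. So all three swaps translate.\<close>
    have "e + b \<noteq> a + b" "e + b + (a + b) = e + a" "e + a \<noteq> a"
      using 4 assms by (simp_all add: add_ac)
    then show ?thesis
      using 4 by (simp add: point_swap_def)
  qed (use assms abb in \<open>auto simp: point_swap_def add.commute\<close>)
qed

lemma ground_restriction_PG: "0 \<notin> X \<Longrightarrow> ground (restriction PG X) = (X :: (bit^'r) set)"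
  by (auto simp: restriction_def)

lemma pointed_swap_restriction:
  fixes X :: "(bit^'r) set"
  assumes "0 \<notin> X" "f \<noteq> 0"
  shows "pointed_swap (restriction PG X) f = restriction PG (point_swap f ` X)"
proof -
  let ?N = "pointed_swap (restriction PG X) f"
  \<comment> \<open>This lifts the equality of ground sets to one of matroids: a restriction of
    \<open>PG\<close> is determined by its ground set.\<close>
  have "?N = restriction PG (ground ?N)"
    by (auto simp: pointed_swap_def restriction_def indeps_PG dest: vec.dependent_zero)
  moreover have "ground ?N = point_swap f ` X"
    using assms ground_pointed_swap[of "restriction PG X" f]
    by (auto simp: ground_restriction_PG point_swap_def)
  ultimately show ?thesis by simp
qed

lemma reach_point_swap:
  fixes X :: "(bit^'r) set"
  assumes "0 \<notin> X" "f \<noteq> 0"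
  shows "swap_or_complement\<^sup>*\<^sup>* (restriction PG X) (restriction PG (point_swap f ` X))"
  unfolding pointed_swap_restriction[OF assms, symmetric] using assms
  by (intro r_into_rtranclp) (auto simp: swap_or_complement_def)

lemma reach_transpose:
  fixes X :: "(bit^'r) set"
  assumes X: "0 \<notin> X" and ab: "a \<noteq> 0" "b \<noteq> 0" "a \<noteq> b"
  shows "swap_or_complement\<^sup>*\<^sup>* (restriction PG X) (restriction PG (Transposition.transpose a b ` X))"
proof -
  have nz: "0 \<notin> point_swap f ` Y" if "0 \<notin> Y" for f :: "bit^'r" and Y
    using that point_swap_nonzero by (metis imageE)
  have "Transposition.transpose a b ` X = (\<lambda>e. point_swap a (point_swap (a + b) (point_swap b e))) ` X"
  proof (rule image_cong[OF refl])
    fix e assume "e \<in> X"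
    then have "e \<noteq> 0" using X by metis
    then show "Transposition.transpose a b e = point_swap a (point_swap (a + b) (point_swap b e))"
      using point_swap_line_eq_transpose ab by metis
  qed
  then have eq: "Transposition.transpose a b ` X = point_swap a ` point_swap (a + b) ` point_swap b ` X"
    by (simp add: image_image)
  have "a + b \<noteq> 0" using ab by (simp add: bit_vec_add_eq_0_iff)
  then show ?thesis
    unfolding eq using X ab nz by (meson reach_point_swap rtranclp_trans)
qed

text \<open>Exchanging a point of \<open>X - Y\<close> with one of \<open>Y - X\<close> makes
  \<open>X - Y\<close> smaller by one; the induction is on its size.\<close>

lemma reach_if_card_eq:
  fixes X Y :: "(bit^'r) set"
  assumes "0 \<notin> X" "0 \<notin> Y" "card X = card Y"
  shows "swap_or_complement\<^sup>*\<^sup>* (restriction PG X) (restriction PG Y)"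
  using assms
proof (induction "card (X - Y)" arbitrary: X)
  case 0
  then have "X \<subseteq> Y" by simp
  then have "X = Y"
    using 0 by (intro card_subset_eq) simp_all
  then show ?case by simp
next
  case (Suc n)
  have "X - Y \<noteq> {}" using Suc.hyps(2) by force
  moreover have "\<not> Y \<subseteq> X"
  proof
    assume "Y \<subseteq> X"
    then have "Y = X"
      using Suc.prems(3) by (intro card_subset_eq) simp_all
    then show False using calculation by simp
  qed
  ultimately obtain a b where ab: "a \<in> X" "a \<notin> Y" "b \<in> Y" "b \<notin> X" by blast
  have T: "Transposition.transpose a b ` X = insert b (X - {a})"
    using ab by (auto simp: Transposition.transpose_def image_iff)
  have "insert b (X - {a}) - Y = (X - Y) - {a}"
    using ab by auto
  then have "n = card (Transposition.transpose a b ` X - Y)"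
    using Suc(2) ab by (simp add: T)
  moreover have "card (Transposition.transpose a b ` X) = card Y"
    using Suc.prems by (simp add: card_image)
  moreover have "0 \<notin> Transposition.transpose a b ` X"
    using Suc.prems ab by (auto simp: T)
  ultimately have "swap_or_complement\<^sup>*\<^sup>* (restriction PG (Transposition.transpose a b ` X)) (restriction PG Y)"
    using Suc.hyps(1) Suc.prems(2) by blast
  moreover have "swap_or_complement\<^sup>*\<^sup>* (restriction PG X) (restriction PG (Transposition.transpose a b ` X))"
    using Suc.prems ab by (intro reach_transpose) auto
  ultimately show ?case by (rule rtranclp_trans[rotated])
qed

lemma reach_complement:
  fixes X H :: "(bit^'r) set"
  assumes "0 \<notin> X" "hyperplane PG H"
  shows "swap_or_complement\<^sup>*\<^sup>* (restriction PG X) (restriction PG (sym_diff X H))"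
  using assms by (intro r_into_rtranclp)
    (auto simp: swap_or_complement_def mtriangle_def ground_restriction_PG)

text \<open>The witness is a coordinate hyperplane. Translation by the unit vector \<open>u\<close>
  exchanges \<open>S\<close> with its complement, which gives both codimension one and half of all
  vectors.\<close>

lemma hyperplane_with_card:
  assumes "CARD('r) > 1"
  obtains H :: "(bit^'r) set" and t
  where "hyperplane PG H" "card H = 2 * t + 1" "CARD(bit^'r) = 4 * t + 4"
proof -
  obtain i :: 'r where True by blast
  define S where "S = {x :: bit^'r. x $ i = 0}"
  define u where "u = (axis i 1 :: bit^'r)"
  have u: "u $ i = 1" by (simp add: u_def)
  have S: "vec.subspace S"
    by (auto simp: S_def vec.subspace_def)
  then have span: "vec.span S = S" by simp
  have shift: "x + u \<in> S \<longleftrightarrow> x \<notin> S" for x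
    using u by (cases "x $ i") (auto simp: S_def)
  have "vec.span (insert u S) = UNIV"
  proof -
    have "x \<in> vec.span (insert u S)" for x
    proof (cases "x \<in> S")
      case False
      then have "x + u + u \<in> vec.span (insert u S)"
        using shift by (intro vec.span_add[of "x + u"] vec.span_base) simp_all
      then show ?thesis by simp
    qed (simp add: vec.span_base)
    then show ?thesis by blast
  qed
  then have "vec.dim (insert u S) = CARD('r)"
    by (metis vec.dim_span vec.dim_UNIV card_cart_basis)
  moreover have "u \<notin> S" by (simp add: S_def u)
  ultimately have "Suc (vec.dim S) = CARD('r)"
    by (simp add: vec.dim_insert span)
  then have hyp: "hyperplane PG (S - {0})"
    using S hyperplane_PG by blast
  have "- S = (\<lambda>x. x + u) ` S"
  proof (intro set_eqI iffI)
    fix x assume "x \<in> - S"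
    then show "x \<in> (\<lambda>x. x + u) ` S"
      using shift by (intro image_eqI[of _ _ "x + u"]) simp_all
  qed (use shift in auto)
  then have "card (- S) = card S"
    by (simp add: card_image inj_on_def)
  moreover have "CARD(bit^'r) = card S + card (- S)"
    by (simp flip: card_Un_disjoint)
  moreover have "CARD(bit^'r) = 2 ^ CARD('r)"
  proof -
    have "(UNIV :: bit set) = {0, 1}"
      by (metis (full_types) UNIV_eq_I bit_not_one_iff insert_iff)
    then have "CARD(bit) = 2" by (metis card_2_iff zero_neq_one)
    then show ?thesis by simp
  qed
  \<comment> \<open>Rank at least two makes the number of vectors a multiple of four, so
    \<open>t\<close> is \<open>2 ^ m - 1\<close> with \<open>m\<close> two less than the
    rank.\<close>
  moreover obtain m where "CARD('r) = Suc (Suc m)"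
    using assms by (metis One_nat_def less_imp_Suc_add add_Suc plus_nat.add_0)
  ultimately have "card S = 2 * 2 ^ m" "CARD(bit^'r) = 4 * 2 ^ m" by simp_all
  moreover obtain t where "2 ^ m = Suc t"
    by (metis not0_implies_Suc power_not_zero zero_neq_numeral)
  moreover have "0 \<in> S" by (simp add: S_def)
  ultimately show thesis
    using hyp by (intro that[of "S - {0}" t]) simp_all
qed

theorem theorem6p3:
  fixes M :: "(bit^'r) matroid"
  assumes "CARD('r) > 1" and "M \<in> PG_restrictions"
  shows "swap_or_complement\<^sup>*\<^sup>* PG M"
proof -
  obtain H :: "(bit^'r) set" and t
    where H: "hyperplane PG H" "card H = 2 * t + 1" and N: "CARD(bit^'r) = 4 * t + 4"
    using hyperplane_with_card assms(1) by blast
  have H0: "0 \<notin> H" using H(1) by (auto simp: hyperplane_def flat_def)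
  have points: "card (UNIV - {0 :: bit^'r}) = 4 * t + 3"
    using N card_Diff_singleton[of 0 "UNIV :: (bit^'r) set", OF UNIV_I] by linarith
  define K where "K = UNIV - {0} - H"
  have K: "card K = 2 * t + 2"
  proof -
    have "card K = card (UNIV - {0 :: bit^'r}) - card H"
      unfolding K_def using H0 by (intro card_Diff_subset) auto
    then show ?thesis using H(2) points by linarith
  qed
  \<comment> \<open>Quantifying over all sets of size \<open>n\<close> lets each later step choose
    how its set meets \<open>H\<close>; by \<open>goodI\<close> a single reachable set
    suffices.\<close>
  define good where "good n \<longleftrightarrow> (\<forall>X :: (bit^'r) set. 0 \<notin> X \<longrightarrow> card X = n \<longrightarrow>
    swap_or_complement\<^sup>*\<^sup>* PG (restriction PG X))" for n
  have goodI: "good (card X)"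
    if "0 \<notin> X" "swap_or_complement\<^sup>*\<^sup>* PG (restriction PG X)" for X :: "(bit^'r) set"
    using that reach_if_card_eq unfolding good_def by (metis rtranclp_trans)
  \<comment> \<open>The bounds say that \<open>k\<close> points fit into \<open>H\<close> and the
    other \<open>n - k\<close> into \<open>K\<close>. The size equation is additive to avoid
    truncated subtraction.\<close>
  have step: "good m"
    if "good n" "k \<le> n" "k \<le> 2 * t + 1" "n \<le> k + (2 * t + 2)" "m + 2 * k = n + (2 * t + 1)"
    for n m k
  proof -
    have "k \<le> card H" using that H by simp
    then obtain A where A: "A \<subseteq> H" "card A = k"
      by (meson obtain_subset_with_card_n)
    have "n - k \<le> card K" using that K by simp
    then obtain B where B: "B \<subseteq> K" "card B = n - k"
      by (meson obtain_subset_with_card_n)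
    have AB: "A \<inter> B = {}" "0 \<notin> A \<union> B"
      using A B H0 by (auto simp: K_def)
    have "card (A \<union> B) = n"
      using A B AB that by (simp add: card_Un_disjoint)
    then have "swap_or_complement\<^sup>*\<^sup>* PG (restriction PG (A \<union> B))"
      using that(1) AB(2) by (auto simp: good_def)
    then have "swap_or_complement\<^sup>*\<^sup>* PG (restriction PG (sym_diff (A \<union> B) H))"
      using reach_complement[OF AB(2) H(1)] by (rule rtranclp_trans)
    moreover have D: "sym_diff (A \<union> B) H = (H - A) \<union> B"
      using A B by (auto simp: K_def)
    moreover have "card ((H - A) \<union> B) = m"
    proof -
      have "card ((H - A) \<union> B) = card (H - A) + card B"
        using B by (intro card_Un_disjoint) (auto simp: K_def)
      then show ?thesis
        using A B H that by (simp add: card_Diff_subset)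
    qed
    moreover have "0 \<notin> (H - A) \<union> B" using AB H0 by auto
    ultimately show "good m" using goodI by metis
  qed
  have "restriction PG (UNIV - {0}) = (PG :: (bit^'r) matroid)"
    by (auto simp: restriction_def PG_def dest: vec.dependent_zero)
  then have "good (card (UNIV - {0 :: bit^'r}))"
    by (intro goodI) simp_all
  then have "good (4 * t + 3)" by (simp only: points)
  \<comment> \<open>Complementing the whole geometry in \<open>H\<close> leaves
    \<open>K\<close>.\<close>
  then have start: "good (2 * t + 2)"
    by (rule step[where k = "2 * t + 1"]) simp_all
  \<comment> \<open>Each step adds one point; at most \<open>2 * t + 2\<close> points fit outside
    \<open>H\<close>, so the last size left is \<open>3 * t + 2\<close>.\<close>
  have up: "good (2 * t + 2 + j)" if "j \<le> t + 1" for j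
    using that
  proof (induction j)
    case (Suc j)
    then have "good (2 * t + 2 + j)" by simp
    then show ?case by (rule step[where k = t]) (use Suc in simp_all)
  qed (use start in simp)
  \<comment> \<open>Each step removes one point and needs \<open>t + 1\<close> points in
    \<open>H\<close>, so the descent ends at \<open>t\<close>.\<close>
  have down: "good (2 * t + 2 - j)" if "j \<le> t + 2" for j
    using that
  proof (induction j)
    case (Suc j)
    then have "good (2 * t + 2 - j)" by simp
    then show ?case by (rule step[where k = "t + 1"]) (use Suc in simp_all)
  qed (use start in simp)
  have middle: "good n" if "t \<le> n" "n \<le> 3 * t + 3" for n
  proof (cases "n \<le> 2 * t + 2")
    case True
    then obtain j where "2 * t + 2 = n + j" by (rule le_Suc_ex[THEN exE])
    then show ?thesis using down[of j] that(1) by simp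
  next
    case False
    then have "2 * t + 2 \<le> n" by simp
    then obtain j where "n = 2 * t + 2 + j" by (rule le_Suc_ex[THEN exE])
    then show ?thesis using up[of j] that(2) by simp
  qed
  have all: "good n" if n: "n \<le> 4 * t + 3" for n
  proof -
    consider "n < t" | "t \<le> n" "n \<le> 3 * t + 3" | "n > 3 * t + 3" by linarith
    then show ?thesis
    proof cases
      case 1
      \<comment> \<open>A set of this size is taken to contain \<open>H\<close>, which the
        complementation deletes.\<close>
      then have "good (n + (2 * t + 1))" by (intro middle) simp_all
      then show ?thesis by (rule step[where k = "2 * t + 1"]) (use 1 in simp_all)
    next
      case 3
      \<comment> \<open>Here the set lies in \<open>K\<close>, with room because
        \<open>n \<le> 4 * t + 3\<close>, and complementation adds all of \<open>H\<close>.\<close>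
      then have "good (n - (2 * t + 1))" using n by (intro middle) simp_all
      then show ?thesis by (rule step[where k = 0]) (use 3 n in simp_all)
    qed (rule middle)
  qed
  obtain X :: "(bit^'r) set" where X: "0 \<notin> X" "M = restriction PG X"
    using assms(2) by (auto simp: PG_restrictions_def)
  have "card X \<le> card (UNIV - {0 :: bit^'r})"
    using X by (intro card_mono) auto
  then have "card X \<le> 4 * t + 3" by (simp only: points)
  from all[OF this] show ?thesis
    using X by (auto simp: good_def)
qed

end
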